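(* Let $c_1,c_2,\dots$ be independent indeterminates over $\mathbb Q$. The Burchnall-Chaundy relation $$P_{n+1}'(z)P_{n-1}(z)-P_{n+1}(z)P_{n-1}'(z)=P_n(z)^2,\qquad n\ge0,$$ with $P_{-1}(z)=P_0(z)=1$ and initial data $P_k(0)=c_k$ for $k\ge1$, has a solution consisting of polynomials $P_n(z)$ in $z$ with coefficients in $\mathbb Q(c_1,c_2,\dots)$, and for every $n\ge1$ these polynomials satisfy $$A_n\,P_n(z)\in\mathbb Z[z;\,c_1^{\pm1},\dots,c_{n-2}^{\pm1},c_{n-1},c_n],\qquad A_n=\prod_{j=1}^n(2j-1)!! .$$
   Context: Here $'$ denotes differentiation in $z$ (the $c_k$ being constants) and $(2k+1)!!=1\cdot3\cdot5\cdots(2k+1)$. For $n=1,2$ no variable is inverted: the ring is $\mathbb Z[z;c_1]$, respectively $\mathbb Z[z;c_1,c_2]$. *)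

theory Defs
  imports
    "HOL-Library.Poly_Mapping"
    "HOL-Computational_Algebra.Polynomial"
    "HOL-Computational_Algebra.Fraction_Field"
begin

text \<open>
  The field \<open>\<rat>(c\<^sub>1, c\<^sub>2, \<dots>)\<close>: a monomial is a finitely supported exponent
  vector, and the exponent of \<open>c\<^sub>k\<close> (for \<open>k \<ge> 1\<close>) is stored at position \<open>k - 1\<close>,
  so that the type contains no indeterminate besides \<open>c\<^sub>1, c\<^sub>2, \<dots>\<close>.
\<close>

type_synonym ratfun = "((nat \<Rightarrow>\<^sub>0 nat) \<Rightarrow>\<^sub>0 rat) fract"

text \<open>Meaningful for \<open>k \<ge> 1\<close> only; the value at \<open>k = 0\<close> is junk.\<close>

definition indet :: "nat \<Rightarrow> ratfun" where
  "indet k = Fract (Poly_Mapping.single (Poly_Mapping.single (k - 1) 1) 1) 1"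

inductive_set generated_subring :: "'a::comm_ring_1 set \<Rightarrow> 'a set" for S :: "'a set" where
  one: "1 \<in> generated_subring S"
| gen: "x \<in> S \<Longrightarrow> x \<in> generated_subring S"
| diff: "\<lbrakk>x \<in> generated_subring S; y \<in> generated_subring S\<rbrakk> \<Longrightarrow> x - y \<in> generated_subring S"
| mult: "\<lbrakk>x \<in> generated_subring S; y \<in> generated_subring S\<rbrakk> \<Longrightarrow> x * y \<in> generated_subring S"

text \<open>
  \<open>\<int>[z; c\<^sub>1\<^sup>\<plusminus>\<^sup>1, \<dots>, c\<^sub>n\<^sub>-\<^sub>2\<^sup>\<plusminus>\<^sup>1, c\<^sub>n\<^sub>-\<^sub>1, c\<^sub>n]\<close> inside the polynomials in \<open>z\<close> over
  \<open>\<rat>(c\<^sub>1, c\<^sub>2, \<dots>)\<close>; the variable \<open>z\<close> is \<open>[:0, 1:]\<close>.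
\<close>

definition int_laurent_ring :: "nat \<Rightarrow> ratfun poly set" where
  "int_laurent_ring n = generated_subring
     ({[:0, 1:]} \<union> {[:indet k:] | k. 1 \<le> k \<and> k \<le> n}
                 \<union> {[:inverse (indet k):] | k. 1 \<le> k \<and> k + 2 \<le> n})"

definition odd_dfact :: "nat \<Rightarrow> nat" where
  "odd_dfact j = (\<Prod>i=1..j. (2 * i - 1))" \<comment> \<open>\<open>(2j - 1)!!\<close>\<close>

definition A_const :: "nat \<Rightarrow> nat" where
  "A_const n = (\<Prod>j=1..n. odd_dfact j)"

text \<open>
  A family \<open>P\<^sub>-\<^sub>1, P\<^sub>0, P\<^sub>1, \<dots>\<close> is encoded as a function on all integers, of which only
  the values at indices \<open>\<ge> -1\<close> matter; \<open>pderiv\<close> is the derivative in \<open>z\<close>.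
\<close>

definition burchnall_chaundy :: "(int \<Rightarrow> ratfun poly) \<Rightarrow> bool" where
  "burchnall_chaundy P \<longleftrightarrow>
     P (-1) = 1 \<and> P 0 = 1 \<and>
     (\<forall>k::nat. k \<ge> 1 \<longrightarrow> poly (P (int k)) 0 = indet k) \<and>
     (\<forall>n::int. n \<ge> 0 \<longrightarrow>
        pderiv (P (n + 1)) * P (n - 1) - P (n + 1) * pderiv (P (n - 1)) = (P n)\<^sup>2)"

end

theory Submission
  imports Defs "Jordan_Normal_Form.Determinant" "HOL-Computational_Algebra.Formal_Power_Series"
begin

text \<open>
  The solution is the Wronskian \<open>P\<^sub>n = W(\<psi>\<^sub>1, \<dots>, \<psi>\<^sub>n)\<close> of polynomials with \<open>\<psi>\<^sub>j'' = \<psi>\<^sub>j\<^sub>-\<^sub>1\<close>,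
  \<open>\<psi>\<^sub>0 = 0\<close>, \<open>\<psi>\<^sub>1' = 1\<close>; their generating function in \<open>x\<close> is
  \<open>\<Psi> = \<alpha> cosh(z \<surd>x) + x sinh(z \<surd>x) / \<surd>x\<close> with \<open>\<alpha> = \<Sum> a\<^sub>j x\<^sup>j\<close>. Because \<open>\<psi>\<^sub>1' = 1\<close>,
  deleting the row of undifferentiated functions and the last column turns \<open>P\<^sub>n\<close> into \<open>P\<^sub>n\<^sub>-\<^sub>2\<close>.
  Hence the Desnanot-Jacobi identity yields the Burchnall-Chaundy relation, and \<open>P\<^sub>n(0)\<close> is an
  integer polynomial in the \<open>a\<^sub>j\<close> that is linear in \<open>a\<^sub>n\<close> with coefficient \<open>\<plusminus>P\<^sub>n\<^sub>-\<^sub>2(0)\<close>, so that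
  the equations \<open>P\<^sub>n(0) = c\<^sub>n\<close> can be solved for \<open>a\<^sub>n\<close> inverting only \<open>c\<^sub>1, \<dots>, c\<^sub>n\<^sub>-\<^sub>2\<close>.

  For the denominators two estimates are combined. The functions \<open>(2j-1)! \<psi>\<^sub>j\<close> have integral
  coefficients and the \<open>i\<close>-th derivative of an integral polynomial is divisible by \<open>i!\<close>; since
  \<open>\<Prod>(2j-1)! = A\<^sub>n \<Prod>(2j-2)!! = A\<^sub>n \<Prod> 2\<^sup>i i!\<close>, some \<open>2\<^sup>k A\<^sub>n P\<^sub>n\<close> is integral. On the other hand,
  dividing \<open>\<Psi>\<close> by \<open>cosh(z \<surd>x)\<close> is a unitriangular column operation, and it leaves only the
  coefficients of \<open>t = tanh(z \<surd>x) / \<surd>x\<close>; by \<open>t' = 1 - x t\<^sup>2\<close> these have odd denominators.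
\<close>

section \<open>Determinants and Wronskians\<close>

text \<open>The first column is (1, 0, ..., 0), so Laplace expansion along it leaves one cofactor;
  its rows start at index 2, and the periodicity of \<open>f\<close> turns it back into the
  unshifted matrix.\<close>

lemma det_shift:
  fixes f :: "nat \<Rightarrow> nat \<Rightarrow> 'a::comm_ring_1"
  assumes "f 1 0 = 1" "\<And>i. f (Suc (Suc i)) 0 = 0" "\<And>i j. f (Suc (Suc i)) (Suc j) = f i j"
  shows "det (mat (Suc n) (Suc n) (\<lambda>(i, j). f (Suc i) j)) = det (mat n n (\<lambda>(i, j). f i j))"
proof -
  let ?A = "mat (Suc n) (Suc n) (\<lambda>(i, j). f (Suc i) j)"
  have "det ?A = (\<Sum>i<Suc n. ?A $$ (i, 0) * cofactor ?A i 0)"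
    by (rule laplace_expansion_column) auto
  also have "\<dots> = cofactor ?A 0 0"
    using assms by (subst sum.lessThan_Suc_shift) (auto intro!: sum.neutral)
  also have "mat_delete ?A 0 0 = mat n n (\<lambda>(i, j). f i j)"
    using assms by (intro eq_matI) (auto simp: mat_delete_def)
  then have "cofactor ?A 0 0 = det (mat n n (\<lambda>(i, j). f i j))"
    by (simp add: cofactor_def)
  finally show ?thesis .
qed

lemma det_mat_2: "det (mat 2 2 f) = f (0, 0) * f (1, 1) - f (0, 1) * f (1, 0)"
  for f :: "nat \<times> nat \<Rightarrow> 'a::comm_ring_1"
  by (subst laplace_expansion_column[of _ 2 0])
    (auto simp: cofactor_def det_single mat_delete_def numeral_2_eq_2)

text \<open>Multiply \<open>A\<close> by the identity matrix with its last two columns replaced by those of the adjugate.\<close>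

lemma desnanot_jacobi:
  fixes A :: "'a::idom mat"
  assumes A: "A \<in> carrier_mat (n + 2) (n + 2)" and nz: "det A \<noteq> 0"
  shows "det A * det (mat n n (($$) A)) =
    det (mat_delete A n n) * det (mat_delete A (n + 1) (n + 1))
    - det (mat_delete A n (n + 1)) * det (mat_delete A (n + 1) n)"
proof -
  define d where "d = det A"
  define B where "B = adj_mat A"
  have B: "B \<in> carrier_mat (n + 2) (n + 2)" and AB: "A * B = d \<cdot>\<^sub>m 1\<^sub>m (n + 2)"
    using adj_mat[OF A] by (auto simp: B_def d_def)
  define X where "X = four_block_mat (1\<^sub>m n) (mat n 2 (\<lambda>(i, j). B $$ (i, j + n)))
    (0\<^sub>m 2 n) (mat 2 2 (\<lambda>(i, j). B $$ (i + n, j + n)))"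
  define Y where "Y = four_block_mat (mat n n (($$) A)) (0\<^sub>m n 2)
    (mat 2 n (\<lambda>(i, j). A $$ (i + n, j))) (d \<cdot>\<^sub>m 1\<^sub>m 2)"
  have X: "X \<in> carrier_mat (n + 2) (n + 2)"
    unfolding X_def by (rule four_block_carrier_mat) auto
  have Y: "Y \<in> carrier_mat (n + 2) (n + 2)"
    unfolding Y_def by (rule four_block_carrier_mat) auto
  have Xr: "X $$ (i, j) = (if j < n then (if i = j then 1 else 0) else B $$ (i, j))"
    if "i < n + 2" "j < n + 2" for i j
    using that unfolding X_def by (auto simp: less_Suc_eq numeral_2_eq_2)
  have Yr: "Y $$ (i, j) = (if j < n then A $$ (i, j) else if i = j then d else 0)"
    if "i < n + 2" "j < n + 2" for i j
    using that unfolding Y_def by (auto simp: less_Suc_eq numeral_2_eq_2)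
  have "A * X = Y"
  proof (rule eq_matI)
    fix i j assume "i < dim_row Y" "j < dim_col Y"
    then have ij: "i < n + 2" "j < n + 2" using Y by auto
    have "(A * X) $$ (i, j) = (\<Sum>k<n + 2. A $$ (i, k) * X $$ (k, j))"
      using ij A X by (auto simp: scalar_prod_def lessThan_atLeast0)
    also have "\<dots> = Y $$ (i, j)"
    proof (cases "j < n")
      case True
      have "(\<Sum>k<n + 2. A $$ (i, k) * X $$ (k, j)) = (\<Sum>k<n + 2. if k = j then A $$ (i, k) else 0)"
        using True ij by (intro sum.cong) (auto simp: Xr)
      then show ?thesis using True ij by (simp add: Yr del: add_2_eq_Suc')
    next
      case False
      have "(\<Sum>k<n + 2. A $$ (i, k) * X $$ (k, j)) = (\<Sum>k<n + 2. A $$ (i, k) * B $$ (k, j))"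
        using False ij by (intro sum.cong) (auto simp: Xr)
      also have "\<dots> = (A * B) $$ (i, j)"
        using ij A B by (auto simp: scalar_prod_def lessThan_atLeast0)
      finally show ?thesis using False ij by (auto simp: AB Yr)
    qed
    finally show "(A * X) $$ (i, j) = Y $$ (i, j)" .
  qed (use A X Y in auto)
  then have "d * det X = det Y"
    using det_mult[OF A X] by (simp add: d_def)
  moreover have "det X = cofactor A n n * cofactor A (n + 1) (n + 1)
      - cofactor A (n + 1) n * cofactor A n (n + 1)"
    unfolding X_def using A
    by (subst det_four_block_mat_lower_left_zero[of _ n _ 2])
      (auto simp: det_mat_2 B_def adj_mat_def)
  \<comment> \<open>The last two columns of \<open>A * X\<close> are those of \<open>d\<close> times
    the identity, so \<open>Y\<close> is block triangular; one factor \<open>d\<close> then cancels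
    because of \<open>nz\<close>.\<close>
  moreover have "det Y = det (mat n n (($$) A)) * (d * d)"
    unfolding Y_def by (subst det_four_block_mat_upper_right_zero[of _ n _ 2])
      (auto simp: power2_eq_square)
  ultimately show ?thesis
    using nz by (simp add: d_def cofactor_def mult.commute mult.assoc)
qed

lemma pderiv_sum: "pderiv (sum f A) = (\<Sum>x\<in>A. pderiv (f x))"
  by (induction A rule: infinite_finite_induct) (auto simp: pderiv_add)

text \<open>By the product rule the derivative is the sum over \<open>k\<close> of the determinants
  with row \<open>k\<close> differentiated. For \<open>k < n\<close> that row coincides with row
  \<open>k + 1\<close>, so only the last summand survives.\<close>

lemma pderiv_det:
  fixes f :: "nat \<Rightarrow> nat \<Rightarrow> 'a::idom poly"
  assumes f: "\<And>i j. pderiv (f i j) = f (Suc i) j"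
  shows "pderiv (det (mat (Suc n) (Suc n) (\<lambda>(i, j). f i j))) =
    det (mat (Suc n) (Suc n) (\<lambda>(i, j). f (if i = n then Suc n else i) j))"
proof -
  let ?P = "{p. p permutes {0..<Suc n}}"
  define M where "M k = mat (Suc n) (Suc n) (\<lambda>(i, j). f (if i = k then Suc k else i) j)" for k
  have det_M: "det (M k) = (\<Sum>p\<in>?P. signof p * (f (Suc k) (p k) * (\<Prod>i\<in>{0..<Suc n} - {k}. f i (p i))))"
    if "k < Suc n" for k
  proof -
    have "det (M k) = (\<Sum>p\<in>?P. signof p * (\<Prod>i = 0..<Suc n. M k $$ (i, p i)))"
      by (rule det_def') (auto simp: M_def)
    also have "\<dots> = (\<Sum>p\<in>?P. signof p * (\<Prod>i = 0..<Suc n. f (if i = k then Suc k else i) (p i)))"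
      by (intro sum.cong arg_cong2[of _ _ _ _ "(*)"] prod.cong refl)
        (auto simp: M_def permutes_in_image[THEN iffD2])
    also have "\<dots> = (\<Sum>p\<in>?P. signof p * (f (Suc k) (p k) * (\<Prod>i\<in>{0..<Suc n} - {k}. f i (p i))))"
      using that by (intro sum.cong arg_cong2[of _ _ _ _ "(*)"] refl) (subst prod.remove[of _ k], auto)
    finally show ?thesis .
  qed
  have sg: "pderiv (signof p * q) = signof p * pderiv q" for p and q :: "'a poly"
    by (cases "sign p = 1") (auto simp: pderiv_minus sign_def)
  have "det (mat (Suc n) (Suc n) (\<lambda>(i, j). f i j)) =
      (\<Sum>p\<in>?P. signof p * (\<Prod>i = 0..<Suc n. mat (Suc n) (Suc n) (\<lambda>(i, j). f i j) $$ (i, p i)))"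
    by (rule det_def') auto
  also have "\<dots> = (\<Sum>p\<in>?P. signof p * (\<Prod>i = 0..<Suc n. f i (p i)))"
    by (intro sum.cong arg_cong2[of _ _ _ _ "(*)"] prod.cong refl) (auto simp: permutes_in_image[THEN iffD2])
  finally have "pderiv (det (mat (Suc n) (Suc n) (\<lambda>(i, j). f i j))) =
      (\<Sum>p\<in>?P. \<Sum>k<Suc n. signof p * (f (Suc k) (p k) * (\<Prod>i\<in>{0..<Suc n} - {k}. f i (p i))))"
    by (simp add: pderiv_sum sg pderiv_prod f sum_distrib_left lessThan_atLeast0 mult.commute
        del: sum.op_ivl_Suc prod.op_ivl_Suc)
  also have "\<dots> = (\<Sum>k<Suc n. det (M k))"
    by (subst sum.swap) (auto simp: det_M intro!: sum.cong)
  also have "\<dots> = det (M n)"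
  proof -
    have "det (M k) = 0" if "k < n" for k
      by (rule det_identical_rows[of _ "Suc n" k "Suc k"]) (use that in \<open>auto simp: M_def row_def\<close>)
    then show ?thesis by simp
  qed
  finally show ?thesis by (simp add: M_def cong: if_cong)
qed

text \<open>The last column is that of the constant function 1 in a Wronskian matrix: all its
  derivatives vanish, and the sign is that of position \<open>(0, k)\<close>.\<close>

lemma det_unit_last_column:
  fixes g :: "nat \<Rightarrow> nat \<Rightarrow> 'a::comm_ring_1"
  shows "det (mat (Suc k) (Suc k) (\<lambda>(i, j). if j = k then (if i = 0 then 1 else 0) else g i j)) =
    (-1) ^ k * det (mat k k (\<lambda>(i, j). g (Suc i) j))"
proof -
  let ?A = "mat (Suc k) (Suc k) (\<lambda>(i, j). if j = k then (if i = 0 then 1 else 0) else g i j)"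
  have "det ?A = (\<Sum>i<Suc k. ?A $$ (i, k) * cofactor ?A i k)"
    by (rule laplace_expansion_column) auto
  also have "\<dots> = cofactor ?A 0 k"
    by (subst sum.lessThan_Suc_shift) (auto intro!: sum.neutral)
  also have "mat_delete ?A 0 k = mat k k (\<lambda>(i, j). g (Suc i) j)"
    by (intro eq_matI) (auto simp: mat_delete_def)
  then have "cofactor ?A 0 k = (-1) ^ k * det (mat k k (\<lambda>(i, j). g (Suc i) j))"
    by (simp add: cofactor_def)
  finally show ?thesis .
qed

text \<open>
  Row \<open>i\<close> holds the \<open>i\<close>-th derivatives and column \<open>j\<close> belongs to \<open>\<psi>\<^sub>j\<^sub>+\<^sub>1\<close>. The Desnanot-Jacobi identity is
  applied to the Wronskian matrix of \<open>\<psi>\<^sub>1, \<dots>, \<psi>\<^sub>n\<^sub>+\<^sub>2, 1\<close>.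
\<close>

lemma wronskian_burchnall_chaundy:
  fixes f :: "nat \<Rightarrow> nat \<Rightarrow> 'a::idom poly"
  defines "W \<equiv> \<lambda>n. det (mat n n (\<lambda>(i, j). f i j))"
  assumes deriv: "\<And>i j. pderiv (f i j) = f (Suc i) j"
    and first: "f 1 0 = 1"
    and shift: "\<And>i j. f (Suc (Suc i)) (Suc j) = f i j"
    and nz: "W (Suc n) \<noteq> 0"
  shows "pderiv (W (n + 2)) * W n - W (n + 2) * pderiv (W n) = (W (Suc n))\<^sup>2"
proof -
  have zero: "f (Suc (Suc i)) 0 = 0" for i
    by (induction i) (use first in \<open>simp_all flip: deriv\<close>)
  define m where "m = Suc n"
  define N where "N = mat (m + 2) (m + 2)
    (\<lambda>(i, j). if j = m + 1 then (if i = 0 then 1 else 0) else f i j)"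
  have N: "N \<in> carrier_mat (m + 2) (m + 2)" by (simp add: N_def)
  have shifted: "det (mat (Suc k) (Suc k) (\<lambda>(i, j). f (Suc i) j)) = W k" for k
    unfolding W_def by (rule det_shift) (use first zero shift in auto)
  have det_N: "det N = (-1) ^ (m + 1) * W m"
    unfolding N_def using det_unit_last_column[of "m + 1" f] shifted[of m] by simp
  have inner: "det (mat m m (($$) N)) = W m"
    unfolding W_def by (rule arg_cong[of _ _ det], rule eq_matI) (auto simp: N_def)
  \<comment> \<open>Without row \<open>m\<close> the last row has order \<open>m + 1\<close>. Once
    the column of the constant 1 is expanded, the orders are 1, ..., m - 1, m + 1, which
    \<open>pderiv_det\<close> recognises as the derivative of the shifted determinant
    \<open>W n\<close>.\<close>
  have "mat_delete N m m = mat (Suc m) (Suc m)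
      (\<lambda>(i, j). if j = m then (if i = 0 then 1 else 0) else f (if i = m then Suc m else i) j)"
    by (rule eq_matI) (auto simp: N_def mat_delete_def m_def less_Suc_eq)
  then have "det (mat_delete N m m) = (-1) ^ m *
      det (mat m m (\<lambda>(i, j). f (if Suc i = m then Suc m else Suc i) j))"
    by (simp only: det_unit_last_column)
  also have "mat m m (\<lambda>(i, j). f (if Suc i = m then Suc m else Suc i) j) =
      mat (Suc n) (Suc n) (\<lambda>(i, j). f (Suc (if i = n then Suc n else i)) j)"
    unfolding m_def by (rule eq_matI) auto
  also have "det \<dots> = pderiv (W n)"
    using pderiv_det[of "\<lambda>i. f (Suc i)" n] shifted[of n] by (simp add: deriv)
  finally have mm: "det (mat_delete N m m) = (-1) ^ m * pderiv (W n)" .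
  have "mat_delete N (m + 1) m = mat (Suc m) (Suc m)
      (\<lambda>(i, j). if j = m then (if i = 0 then 1 else 0) else f i j)"
    by (rule eq_matI) (auto simp: N_def mat_delete_def)
  then have m1m: "det (mat_delete N (m + 1) m) = (-1) ^ m * W n"
    using shifted[of n] by (simp only: det_unit_last_column m_def)
  have "mat_delete N (m + 1) (m + 1) = mat (m + 1) (m + 1) (\<lambda>(i, j). f i j)"
    by (rule eq_matI) (auto simp: N_def mat_delete_def)
  then have m1m1: "det (mat_delete N (m + 1) (m + 1)) = W (m + 1)"
    by (simp add: W_def)
  have "mat_delete N m (m + 1) = mat (Suc m) (Suc m) (\<lambda>(i, j). f (if i = m then Suc m else i) j)"
    by (rule eq_matI) (auto simp: N_def mat_delete_def)
  then have mm1: "det (mat_delete N m (m + 1)) = pderiv (W (m + 1))"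
    unfolding W_def using pderiv_det[of f m, OF deriv] by simp
  have "det N \<noteq> 0" using nz by (simp add: det_N m_def)
  from desnanot_jacobi[OF N this]
  have "(-1) ^ m * (W m)\<^sup>2 = (-1) ^ m * (pderiv (W (m + 1)) * W n - W (m + 1) * pderiv (W n))"
    unfolding det_N inner mm m1m m1m1 mm1 by (simp add: algebra_simps power2_eq_square)
  then show ?thesis by (simp add: m_def)
qed

section \<open>The Wronskian solution\<close>

definition divided_power :: "nat \<Rightarrow> 'k::field_char_0 poly" where
  "divided_power m = monom (inverse (fact m)) m"

lemma pderiv_divided_power [simp]:
  "pderiv (divided_power 0) = 0" "pderiv (divided_power (Suc m)) = divided_power m"
  by (auto simp: divided_power_def pderiv_monom field_simps simp del: of_nat_Suc)

lemma divided_power_0: "divided_power 0 = 1"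
  by (simp add: divided_power_def)

lemma poly_divided_power_0: "poly (divided_power m) 0 = (if m = 0 then 1 else 0)"
  by (simp add: divided_power_def poly_monom power_0_left)

text \<open>Series in x have polynomials in z as coefficients; this is the derivation in z, under
  which x is a constant, as opposed to the formal derivative in x.\<close>

definition fps_pderiv :: "'k::field_char_0 poly fps \<Rightarrow> 'k poly fps" where
  "fps_pderiv f = Abs_fps (\<lambda>n. pderiv (fps_nth f n))"

lemma fps_nth_fps_pderiv [simp]: "fps_nth (fps_pderiv f) n = pderiv (fps_nth f n)"
  by (simp add: fps_pderiv_def)

lemma fps_pderiv_add: "fps_pderiv (f + g) = fps_pderiv f + fps_pderiv g"
  by (rule fps_ext) (simp add: pderiv_add)

lemma fps_pderiv_mult: "fps_pderiv (f * g) = f * fps_pderiv g + fps_pderiv f * g"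
  by (rule fps_ext) (simp add: fps_mult_nth pderiv_sum pderiv_mult sum.distrib mult.commute[of "fps_nth g _"])

lemma fps_pderiv_X_mult: "fps_pderiv (fps_X * f) = fps_X * fps_pderiv f"
  by (rule fps_ext) simp

text \<open>The series \<open>cosh(z \<surd>x)\<close> and \<open>sinh(z \<surd>x) / \<surd>x\<close> in \<open>x\<close>.\<close>

definition cosh_fps :: "'k::field_char_0 poly fps" where
  "cosh_fps = Abs_fps (\<lambda>i. divided_power (2 * i))"

definition sinh_fps :: "'k::field_char_0 poly fps" where
  "sinh_fps = Abs_fps (\<lambda>i. divided_power (2 * i + 1))"

lemma fps_pderiv_cosh: "fps_pderiv cosh_fps = fps_X * sinh_fps"
proof (rule fps_ext)
  fix n show "fps_nth (fps_pderiv cosh_fps) n = fps_nth (fps_X * sinh_fps) n"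
    by (cases n) (auto simp: cosh_fps_def sinh_fps_def)
qed

lemma fps_pderiv_sinh: "fps_pderiv sinh_fps = cosh_fps"
  by (rule fps_ext) (auto simp: cosh_fps_def sinh_fps_def)

text \<open>The series \<alpha> of free parameters. Its constant coefficient is forced to 0, so
  \<open>a 0\<close> never enters and \<open>psi_fps\<close> starts at x.\<close>

definition param_fps :: "(nat \<Rightarrow> 'k::field_char_0) \<Rightarrow> 'k poly fps" where
  "param_fps a = Abs_fps (\<lambda>j. if j = 0 then 0 else [:a j:])"

lemma fps_nth_param: "fps_nth (param_fps a) j = (if j = 0 then 0 else [:a j:])"
  by (simp add: param_fps_def)

lemma fps_pderiv_param: "fps_pderiv (param_fps a) = 0"
  by (rule fps_ext) (auto simp: param_fps_def)

definition psi_fps :: "(nat \<Rightarrow> 'k::field_char_0) \<Rightarrow> 'k poly fps" where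
  "psi_fps a = param_fps a * cosh_fps + fps_X * sinh_fps"

definition psi_deriv :: "(nat \<Rightarrow> 'k::field_char_0) \<Rightarrow> nat \<Rightarrow> 'k poly fps" where
  "psi_deriv a i = (fps_pderiv ^^ i) (psi_fps a)"

text \<open>Differentiation in z sends cosh to x times sinh and sinh to cosh (in the normalisation
  used here), so two derivatives amount to a factor x.\<close>

lemma psi_deriv_even: "psi_deriv a (2 * s) = fps_X ^ s * (param_fps a * cosh_fps + fps_X * sinh_fps)"
  and psi_deriv_odd: "psi_deriv a (2 * s + 1) = fps_X ^ Suc s * (param_fps a * sinh_fps + cosh_fps)"
proof -
  have step: "psi_deriv a (Suc i) = fps_pderiv (psi_deriv a i)" for i
    by (simp add: psi_deriv_def)
  have X: "fps_pderiv (fps_X ^ s * f) = fps_X ^ s * fps_pderiv f" for s and f :: "'a poly fps"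
    by (induction s) (simp_all add: fps_pderiv_X_mult mult.assoc)
  have odd: "psi_deriv a (2 * s + 1) = fps_X ^ Suc s * (param_fps a * sinh_fps + cosh_fps)"
    if "psi_deriv a (2 * s) = fps_X ^ s * (param_fps a * cosh_fps + fps_X * sinh_fps)" for s
  proof -
    have "psi_deriv a (2 * s + 1) = fps_pderiv (psi_deriv a (2 * s))"
      using step[of "2 * s"] by simp
    also have "\<dots> = fps_X ^ Suc s * (param_fps a * sinh_fps + cosh_fps)"
      unfolding that X
      unfolding fps_pderiv_add fps_pderiv_X_mult
      unfolding fps_pderiv_mult fps_pderiv_param
        fps_pderiv_cosh fps_pderiv_sinh by (simp add: algebra_simps)
    finally show ?thesis .
  qed
  show even: "psi_deriv a (2 * s) = fps_X ^ s * (param_fps a * cosh_fps + fps_X * sinh_fps)" for s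
  proof (induction s)
    case (Suc s)
    have "psi_deriv a (2 * Suc s) = fps_pderiv (psi_deriv a (2 * s + 1))"
      using step[of "2 * s + 1"] by simp
    also have "\<dots> = fps_X ^ Suc s * (param_fps a * cosh_fps + fps_X * sinh_fps)"
      unfolding odd[OF Suc] X
      unfolding fps_pderiv_add fps_pderiv_mult fps_pderiv_param
        fps_pderiv_cosh fps_pderiv_sinh by simp
    finally show ?case .
  qed (simp add: psi_deriv_def psi_fps_def)
  from odd[OF even] show "psi_deriv a (2 * s + 1) = fps_X ^ Suc s * (param_fps a * sinh_fps + cosh_fps)" .
qed

definition wronskian_entry :: "(nat \<Rightarrow> 'k::field_char_0) \<Rightarrow> nat \<Rightarrow> nat \<Rightarrow> 'k poly" where
  "wronskian_entry a i j = fps_nth (psi_deriv a i) (Suc j)"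

definition wronskian :: "(nat \<Rightarrow> 'k::field_char_0) \<Rightarrow> nat \<Rightarrow> 'k poly" where
  "wronskian a n = det (mat n n (\<lambda>(i, j). wronskian_entry a i j))"

lemma pderiv_wronskian_entry: "pderiv (wronskian_entry a i j) = wronskian_entry a (Suc i) j"
  by (simp add: wronskian_entry_def psi_deriv_def)

lemma wronskian_entry_1_0: "wronskian_entry a (Suc 0) 0 = 1"
  using psi_deriv_odd[of a 0]
  by (simp add: wronskian_entry_def fps_mult_nth fps_nth_param cosh_fps_def divided_power_0)

lemma psi_deriv_nth_0: "fps_nth (psi_deriv a i) 0 = 0"
  by (cases i rule: parity_cases; elim evenE oddE)
    (simp_all add: psi_deriv_even psi_deriv_odd[unfolded add_Suc_right add_0_right One_nat_def]
      fps_mult_nth fps_nth_param)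

text \<open>Read coefficientwise, this is the relation that the second derivative of the j-th
  function is the preceding one; it makes the Wronskian matrix periodic along diagonals.\<close>

lemma psi_deriv_Suc_Suc: "psi_deriv a (Suc (Suc i)) = fps_X * psi_deriv a i"
proof (cases "even i")
  case True
  then obtain s where "i = 2 * s" by (elim evenE)
  then show ?thesis using psi_deriv_even[of a "Suc s"] by (simp add: psi_deriv_even mult.assoc)
next
  case False
  then obtain s where "i = 2 * s + 1" by (elim oddE)
  then show ?thesis using psi_deriv_odd[of a "Suc s"] psi_deriv_odd[of a s] by (simp add: mult.assoc)
qed

lemma wronskian_entry_Suc_Suc: "wronskian_entry a (Suc (Suc i)) (Suc j) = wronskian_entry a i j"
  by (simp add: wronskian_entry_def psi_deriv_Suc_Suc)

text \<open>At z = 0 the cosh series becomes 1 and the sinh series 0. Hence a derivative of order 2s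
  leaves x^s \<alpha>, and one of order 2s + 1 leaves x^(s+1).\<close>

lemma poly_wronskian_entry_0:
  "poly (wronskian_entry a i j) 0 =
    (if even i then (if i div 2 \<le> j then a (Suc j - i div 2) else 0)
     else (if j = i div 2 then 1 else 0))"
proof (induction i arbitrary: j rule: less_induct)
  case (less i)
  have c: "poly (fps_nth (f * cosh_fps) n) 0 = poly (fps_nth f n) 0" for f :: "'a poly fps" and n
  proof -
    have "poly (fps_nth (f * cosh_fps) n) 0 =
        (\<Sum>k = 0..n. if k = n then poly (fps_nth f n) 0 else 0)"
      unfolding fps_mult_nth poly_sum
      by (intro sum.cong) (auto simp: cosh_fps_def poly_divided_power_0)
    then show ?thesis by simp
  qed
  have s: "poly (fps_nth (f * sinh_fps) n) 0 = 0" for f :: "'a poly fps" and n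
    unfolding fps_mult_nth poly_sum by (intro sum.neutral) (auto simp: sinh_fps_def poly_divided_power_0)
  consider "i = 0" | "i = 1" | i' where "i = Suc (Suc i')"
    by (metis One_nat_def not0_implies_Suc)
  then show ?case
  proof cases
    case 1
    then show ?thesis using c[of "param_fps a" "Suc j"] s[of fps_X "Suc j"] psi_deriv_even[of a 0]
      by (simp add: wronskian_entry_def fps_nth_param)
  next
    case 2
    then show ?thesis using s[of "fps_X * param_fps a" "Suc j"] c[of "fps_X" "Suc j"] psi_deriv_odd[of a 0]
      by (simp add: wronskian_entry_def distrib_left mult.assoc fps_X_def)
  next
    case (3 i')
    show ?thesis
    proof (cases j)
      case 0
      then show ?thesis using 3 psi_deriv_nth_0[of a i'] by (simp add: wronskian_entry_def psi_deriv_Suc_Suc)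
    next
      case (Suc j')
      then show ?thesis using 3 less[of i' j'] by (simp add: wronskian_entry_Suc_Suc)
    qed
  qed
qed

lemma burchnall_chaundy_wronskian:
  assumes "wronskian a (Suc n) \<noteq> 0"
  shows "pderiv (wronskian a (n + 2)) * wronskian a n - wronskian a (n + 2) * pderiv (wronskian a n) =
    (wronskian a (Suc n))\<^sup>2"
  unfolding wronskian_def
  by (rule wronskian_burchnall_chaundy)
    (use assms in \<open>simp_all add: pderiv_wronskian_entry wronskian_entry_1_0
      wronskian_entry_Suc_Suc wronskian_def\<close>)

lemma wronskian_0: "wronskian a 0 = 1"
  by (simp add: wronskian_def)

lemma pderiv_wronskian_1: "pderiv (wronskian a (Suc 0)) = 1"
  by (simp add: wronskian_def det_single pderiv_wronskian_entry wronskian_entry_1_0)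

section \<open>Constant terms of the Wronskians\<close>

text \<open>The closed form of \<open>wronskian a n\<close> at \<open>z = 0\<close>.\<close>

definition const_wronskian :: "(nat \<Rightarrow> 'k::comm_ring_1) \<Rightarrow> nat \<Rightarrow> 'k" where
  "const_wronskian a n = det (mat n n (\<lambda>(i, j).
    if even i then (if i div 2 \<le> j then a (Suc j - i div 2) else 0)
    else (if j = i div 2 then 1 else 0)))"

lemma poly_wronskian_0: "poly (wronskian a n) 0 = const_wronskian a n"
proof -
  interpret comm_ring_hom "\<lambda>p. poly p (0::'a)" by standard auto
  show ?thesis unfolding wronskian_def hom_det[symmetric] const_wronskian_def
    by (rule arg_cong[of _ _ det], rule eq_matI) (auto simp: poly_wronskian_entry_0)
qed

lemma const_wronskian_cong:
  assumes "\<And>k. 1 \<le> k \<Longrightarrow> k \<le> n \<Longrightarrow> a k = b k"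
  shows "const_wronskian a n = const_wronskian b n"
  unfolding const_wronskian_def
  by (rule arg_cong[of _ _ det], rule eq_matI) (auto simp: assms)

text \<open>Expansion along row 0. The parameter \<open>a (Suc n)\<close> occurs only in the top
  right corner, since lower even rows are shifted to the right; the cofactor of that corner is
  evaluated by \<open>det_shift\<close>.\<close>

lemma const_wronskian_last:
  "const_wronskian a (Suc n) =
    const_wronskian (a(Suc n := 0)) (Suc n) + (-1) ^ n * a (Suc n) * const_wronskian a (n - 1)"
proof -
  define f where "f a i j = (if even i then (if i div 2 \<le> j then a (Suc j - i div 2) else 0)
    else (if j = i div 2 then 1 else 0))" for a :: "nat \<Rightarrow> 'a" and i j :: nat
  define M where "M a = mat (Suc n) (Suc n) (\<lambda>(i, j). f a i j)" for a
  let ?b = "a(Suc n := 0)"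
  have cof: "cofactor (M ?b) 0 j = cofactor (M a) 0 j" if "j < Suc n" for j
  proof -
    have "mat_delete (M ?b) 0 j = mat_delete (M a) 0 j"
      by (rule eq_matI) (auto simp: M_def f_def mat_delete_def)
    then show ?thesis by (simp add: cofactor_def)
  qed
  have "mat_delete (M a) 0 n = mat n n (\<lambda>(i, j). f a (Suc i) j)"
    by (rule eq_matI) (auto simp: M_def mat_delete_def)
  moreover have "det (mat n n (\<lambda>(i, j). f a (Suc i) j)) = const_wronskian a (n - 1)"
  \<comment> \<open>For \<open>n = 0\<close> both sides are empty determinants, so the truncated
    \<open>n - 1\<close> gives the correct coefficient 1.\<close>
  proof (cases n)
    case (Suc m)
    then show ?thesis
      using det_shift[of "f a" m] by (simp add: f_def const_wronskian_def)
  qed (simp add: const_wronskian_def)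
  ultimately have cof_n: "cofactor (M a) 0 n = (-1) ^ n * const_wronskian a (n - 1)"
    by (simp add: cofactor_def)
  have expand: "const_wronskian b (Suc n) = (\<Sum>j<Suc n. b (Suc j) * cofactor (M b) 0 j)" for b
  proof -
    have "const_wronskian b (Suc n) = det (M b)"
      by (simp add: const_wronskian_def M_def f_def)
    also have "\<dots> = (\<Sum>j<Suc n. M b $$ (0, j) * cofactor (M b) 0 j)"
      by (rule laplace_expansion_row) (auto simp: M_def)
    finally show ?thesis by (simp add: M_def f_def)
  qed
  have "(\<Sum>j<n. ?b (Suc j) * cofactor (M ?b) 0 j) = (\<Sum>j<n. a (Suc j) * cofactor (M a) 0 j)"
    by (intro sum.cong) (auto simp: cof)
  then show ?thesis
    unfolding expand by (simp add: cof_n)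
qed

section \<open>Denominators\<close>

text \<open>Subrings are sets inside a fixed type, so that integral elements, their localization and
  the constants among them can be treated alike; the axioms mirror the rules of
  \<open>generated_subring\<close>.\<close>

locale unital_subring =
  fixes S :: "'a::comm_ring_1 set"
  assumes one_mem: "1 \<in> S"
    and diff_mem: "x \<in> S \<Longrightarrow> y \<in> S \<Longrightarrow> x - y \<in> S"
    and mult_mem: "x \<in> S \<Longrightarrow> y \<in> S \<Longrightarrow> x * y \<in> S"
begin

lemma zero_mem: "0 \<in> S"
  using diff_mem[OF one_mem one_mem] by simp

lemma uminus_mem: "x \<in> S \<Longrightarrow> - x \<in> S"
  using diff_mem[OF zero_mem, of x] by simp

lemma add_mem: "x \<in> S \<Longrightarrow> y \<in> S \<Longrightarrow> x + y \<in> S"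
  using diff_mem[of x "- y"] uminus_mem[of y] by simp

lemma sum_mem: "(\<And>x. x \<in> A \<Longrightarrow> f x \<in> S) \<Longrightarrow> sum f A \<in> S"
  by (induction A rule: infinite_finite_induct) (auto simp: zero_mem add_mem)

lemma prod_mem: "(\<And>x. x \<in> A \<Longrightarrow> f x \<in> S) \<Longrightarrow> prod f A \<in> S"
  by (induction A rule: infinite_finite_induct) (auto simp: one_mem mult_mem)

lemma power_mem: "x \<in> S \<Longrightarrow> x ^ n \<in> S"
  by (induction n) (auto simp: one_mem mult_mem)

lemma of_nat_mem: "of_nat n \<in> S"
  by (induction n) (auto simp: zero_mem one_mem add_mem)

lemma of_int_mem: "of_int k \<in> S"
  by (cases k rule: int_cases2) (auto simp: of_nat_mem uminus_mem)

lemma det_mem: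
  assumes "\<And>i j. i < n \<Longrightarrow> j < n \<Longrightarrow> f i j \<in> S"
  shows "det (mat n n (\<lambda>(i, j). f i j)) \<in> S"
  by (subst det_def'[of _ n])
    (auto intro!: sum_mem mult_mem of_int_mem prod_mem simp: assms permutes_in_image[THEN iffD2])

text \<open>Bezout. This is how the power-of-2 estimate and the odd-denominator estimate are
  merged.\<close>

lemma coprime_multiples_mem:
  assumes "of_nat b * x \<in> S" "of_nat c * x \<in> S" "coprime b c"
  shows "x \<in> S"
proof -
  obtain u v where "u * int b + v * int c = 1"
    using bezout_int[of "int b" "int c"] assms(3) by auto
  then have "x = (of_int u * of_nat b + of_int v * of_nat c) * x"
    by (metis mult_1 of_int_1 of_int_add of_int_mult of_int_of_nat_eq)
  also have "\<dots> = of_int u * (of_nat b * x) + of_int v * (of_nat c * x)"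
    by (simp add: algebra_simps)
  also have "\<dots> \<in> S" by (intro add_mem mult_mem of_int_mem assms)
  finally show ?thesis .
qed

end

text \<open>Elements with an odd denominator relative to \<open>S\<close>, that is, \<open>S\<close>
  localized at the prime 2 within the ambient ring.\<close>

definition odd_localization :: "'a::comm_ring_1 set \<Rightarrow> 'a set" where
  "odd_localization S = {x. \<exists>b::nat. odd b \<and> of_nat b * x \<in> S}"

lemma subset_odd_localization: "x \<in> S \<Longrightarrow> x \<in> odd_localization S"
  unfolding odd_localization_def by (intro CollectI exI[of _ 1]) auto

lemma odd_localization_divide:
  assumes "odd m" "of_nat m * x \<in> odd_localization S"
  shows "x \<in> odd_localization S"
proof -
  obtain b :: nat where "odd b" "of_nat b * (of_nat m * x) \<in> S"
    using assms by (auto simp: odd_localization_def)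
  then show ?thesis unfolding odd_localization_def
    by (intro CollectI exI[of _ "b * m"]) (use assms(1) in \<open>auto simp: mult.assoc\<close>)
qed

lemma unital_subring_odd_localization:
  assumes "unital_subring S" shows "unital_subring (odd_localization S)"
proof -
  interpret unital_subring S by fact
  show ?thesis
  proof
    show "1 \<in> odd_localization S" by (rule subset_odd_localization) (rule one_mem)
  next
    fix x y assume "x \<in> odd_localization S" "y \<in> odd_localization S"
    then obtain b c :: nat where bc: "odd b" "of_nat b * x \<in> S" "odd c" "of_nat c * y \<in> S"
      by (auto simp: odd_localization_def)
    have "of_nat (b * c) * (x - y) = of_nat c * (of_nat b * x) - of_nat b * (of_nat c * y)"
      by (simp add: algebra_simps)
    also have "\<dots> \<in> S" by (intro diff_mem mult_mem of_nat_mem bc)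
    finally show "x - y \<in> odd_localization S"
      using bc unfolding odd_localization_def by (intro CollectI exI[of _ "b * c"]) auto
    have "of_nat (b * c) * (x * y) = (of_nat b * x) * (of_nat c * y)"
      by (simp add: algebra_simps)
    also have "\<dots> \<in> S" by (intro mult_mem bc)
    finally show "x * y \<in> odd_localization S"
      using bc unfolding odd_localization_def by (intro CollectI exI[of _ "b * c"]) auto
  qed
qed

section \<open>Determinant operations and the odd-denominator estimate\<close>

lemma det_scale_rows:
  fixes f :: "nat \<Rightarrow> nat \<Rightarrow> 'a::comm_ring_1"
  shows "det (mat n n (\<lambda>(i, j). r i * f i j)) = (\<Prod>i<n. r i) * det (mat n n (\<lambda>(i, j). f i j))"
proof -
  have d: "det (mat n n (\<lambda>(i, j). h i j)) =
      (\<Sum>p | p permutes {0..<n}. signof p * (\<Prod>i = 0..<n. h i (p i)))" for h :: "nat \<Rightarrow> nat \<Rightarrow> 'a"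
    by (subst det_def'[of _ n])
      (auto intro!: sum.cong arg_cong2[of _ _ _ _ "(*)"] prod.cong simp: permutes_in_image[THEN iffD2])
  show ?thesis
    unfolding d by (simp add: prod.distrib sum_distrib_left lessThan_atLeast0 algebra_simps)
qed

lemma det_scale_columns:
  fixes f :: "nat \<Rightarrow> nat \<Rightarrow> 'a::comm_ring_1"
  shows "det (mat n n (\<lambda>(i, j). r j * f i j)) = (\<Prod>i<n. r i) * det (mat n n (\<lambda>(i, j). f i j))"
proof -
  have t: "det (mat n n (\<lambda>(i, j). h i j)) = det (mat n n (\<lambda>(i, j). h j i))" for h :: "nat \<Rightarrow> nat \<Rightarrow> 'a"
    by (subst det_transpose[of _ n, symmetric]) (auto intro!: arg_cong[of _ _ det] eq_matI)
  show ?thesis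
    using det_scale_rows[of n r "\<lambda>i j. f j i"] t[of "\<lambda>i j. r j * f i j"] t[of f] by simp
qed

text \<open>Multiplication by \<open>u\<close> acts on coefficient rows as an upper unitriangular
  Toeplitz matrix. The vanishing coefficients at 0 keep the columns 1, ..., n closed under
  it.\<close>

lemma det_fps_mult_unit:
  fixes F :: "nat \<Rightarrow> 'a::comm_ring_1 fps"
  assumes F: "\<And>i. fps_nth (F i) 0 = 0" and u: "fps_nth u 0 = 1"
  shows "det (mat n n (\<lambda>(i, j). fps_nth (F i * u) (Suc j))) = det (mat n n (\<lambda>(i, j). fps_nth (F i) (Suc j)))"
proof -
  define M where "M = mat n n (\<lambda>(i, j). fps_nth (F i) (Suc j))"
  define U where "U = mat n n (\<lambda>(j, k). if j \<le> k then fps_nth u (k - j) else 0)"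
  have "M * U = mat n n (\<lambda>(i, j). fps_nth (F i * u) (Suc j))"
  proof (rule eq_matI)
    fix i k assume "i < dim_row (mat n n (\<lambda>(i, j). fps_nth (F i * u) (Suc j)))"
      "k < dim_col (mat n n (\<lambda>(i, j). fps_nth (F i * u) (Suc j)))"
    then have ik: "i < n" "k < n" by auto
    have "(M * U) $$ (i, k) = (\<Sum>j<n. fps_nth (F i) (Suc j) * (if j \<le> k then fps_nth u (k - j) else 0))"
      using ik by (simp add: M_def U_def scalar_prod_def lessThan_atLeast0)
    also have "\<dots> = (\<Sum>j\<le>k. fps_nth (F i) (Suc j) * fps_nth u (k - j))"
      using ik by (intro sum.mono_neutral_cong_right) auto
    also have "\<dots> = fps_nth (F i * u) (Suc k)"
      by (simp add: fps_mult_nth F sum.atMost_Suc_shift atLeast0AtMost del: sum.atMost_Suc)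
    finally show "(M * U) $$ (i, k) = mat n n (\<lambda>(i, j). fps_nth (F i * u) (Suc j)) $$ (i, k)"
      using ik by simp
  qed (auto simp: M_def U_def)
  moreover have "det U = 1"
  proof -
    have "det U = prod_list (diag_mat U)"
      by (rule det_upper_triangular[of _ n]) (auto simp: U_def upper_triangular_def)
    also have "diag_mat U = map (\<lambda>_. 1) [0..<n]"
      by (auto simp: diag_mat_def U_def u)
    also have "prod_list \<dots> = 1" by (induction n) auto
    finally show ?thesis .
  qed
  ultimately show ?thesis
    using det_mult[of M n U] by (simp add: M_def U_def)
qed

lemma fps_cosh_inverse_exists: "\<exists>u::'k::field_char_0 poly fps. cosh_fps * u = 1"
  by (rule exI[of _ "fps_right_inverse cosh_fps 1"], rule fps_right_inverse)
    (simp add: cosh_fps_def divided_power_0)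

text \<open>The Riccati equation expresses the derivative of each coefficient of \<open>t\<close>
  through products of earlier ones. Integrating a multiple of z^(2k) divides only by the odd number
  2k + 1.\<close>

lemma fps_tanh_coeff:
  fixes u :: "'k::field_char_0 poly fps"
  assumes u: "cosh_fps * u = 1"
  defines "t \<equiv> sinh_fps * u"
  shows "\<exists>c. fps_nth t k = monom c (2 * k + 1) \<and> c \<in> odd_localization (range of_int)"
proof (induction k rule: less_induct)
  case (less k)
  interpret Z: unital_subring "range (of_int :: int \<Rightarrow> 'k)"
  proof
    show "(1 :: 'k) \<in> range of_int" by (metis of_int_1 range_eqI)
    fix x y :: 'k assume "x \<in> range of_int" "y \<in> range of_int"
    then obtain i j where "x = of_int i" "y = of_int j" by auto
    then show "x - y \<in> range of_int" "x * y \<in> range of_int"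
      by (metis of_int_diff range_eqI, metis of_int_mult range_eqI)
  qed
  interpret L: unital_subring "odd_localization (range (of_int :: int \<Rightarrow> 'k))"
    by (rule unital_subring_odd_localization) (rule Z.unital_subring_axioms)
  \<comment> \<open>This is the derivative of \<open>t * cosh_fps = sinh_fps\<close>; multiplying it
    by \<open>u\<close> then gives the Riccati equation.\<close>
  have "fps_pderiv t * cosh_fps + t * (fps_X * sinh_fps) = cosh_fps"
  proof -
    have "t * cosh_fps = sinh_fps" using u by (simp add: t_def mult.assoc mult.commute[of u])
    then have "fps_pderiv (t * cosh_fps) = cosh_fps" by (simp add: fps_pderiv_sinh)
    then show ?thesis by (simp add: fps_pderiv_mult fps_pderiv_cosh add.commute)
  qed
  then have "(fps_pderiv t * cosh_fps + t * (fps_X * sinh_fps)) * u = cosh_fps * u" by simp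
  then have "fps_pderiv t * (cosh_fps * u) + fps_X * (t * (sinh_fps * u)) = cosh_fps * u"
    by (simp only: distrib_right mult.assoc mult.left_commute[of t])
  then have riccati: "fps_pderiv t = 1 - fps_X * (t * t)"
    by (simp add: u t_def[symmetric] algebra_simps)
  have "\<exists>c. \<forall>i<k. fps_nth t i = monom (c i) (2 * i + 1) \<and> c i \<in> odd_localization (range of_int)"
    using less by metis
  then obtain c where c: "fps_nth t i = monom (c i) (2 * i + 1)" "c i \<in> odd_localization (range of_int)"
    if "i < k" for i by blast
  obtain e where e: "pderiv (fps_nth t k) = monom e (2 * k)" "e \<in> odd_localization (range of_int)"
  proof (cases k)
    case 0
    then show ?thesis using that[of 1] riccati L.one_mem
      by (metis fps_nth_fps_pderiv fps_sub_nth fps_one_nth fps_X_mult_nth diff_zero monom_eq_1 mult_0_right)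
  next
    case (Suc m)
    have "pderiv (fps_nth t k) = - (\<Sum>i=0..m. fps_nth t i * fps_nth t (m - i))"
    proof -
      have "pderiv (fps_nth t k) = - fps_nth (t * t) m"
        using arg_cong[OF riccati, of "\<lambda>f. fps_nth f k"] Suc by simp
      then show ?thesis by (simp add: fps_mult_nth)
    qed
    also have "\<dots> = - (\<Sum>i=0..m. monom (c i * c (m - i)) (2 * k))"
      using Suc by (intro arg_cong[of _ _ uminus] sum.cong) (auto simp: c mult_monom algebra_simps)
    also have "\<dots> = monom (- (\<Sum>i=0..m. c i * c (m - i))) (2 * k)"
      by (simp add: monom_sum[symmetric] minus_monom)
    finally have "pderiv (fps_nth t k) = monom (- (\<Sum>i=0..m. c i * c (m - i))) (2 * k)" .
    moreover have "- (\<Sum>i=0..m. c i * c (m - i)) \<in> odd_localization (range of_int)"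
      using Suc by (intro L.uminus_mem L.sum_mem L.mult_mem c) auto
    ultimately show ?thesis by (rule that)
  qed
  define d where "d = e / of_nat (2 * k + 1)"
  have nz: "of_nat (2 * k + 1) \<noteq> (0 :: 'k)" by (simp only: of_nat_eq_0_iff)
  have "pderiv (fps_nth t k - monom d (2 * k + 1)) = 0"
    using nz by (simp add: pderiv_diff pderiv_monom e d_def)
  then obtain h where h: "fps_nth t k - monom d (2 * k + 1) = [:h:]"
    by (metis pderiv_iszero)
  \<comment> \<open>Fixes the constant of integration: every coefficient of \<open>sinh_fps\<close>
    vanishes at z = 0.\<close>
  have "poly (fps_nth t k) 0 = 0"
    unfolding t_def fps_mult_nth poly_sum
    by (intro sum.neutral) (auto simp: sinh_fps_def poly_divided_power_0)
  then have "h = 0" using arg_cong[OF h, of "\<lambda>p. poly p 0"] by (simp add: poly_monom)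
  then have "fps_nth t k = monom d (2 * k + 1)" using h by simp
  moreover have "d \<in> odd_localization (range of_int)"
  proof (rule odd_localization_divide)
    have "of_nat (2 * k + 1) * d = e"
      unfolding d_def by (rule nonzero_mult_div_cancel_left[OF nz, folded times_divide_eq_right])
    with e(2) show "of_nat (2 * k + 1) * d \<in> odd_localization (range of_int)" by (simp only:)
  qed simp
  ultimately show ?case by blast
qed

text \<open>After multiplication by \<open>u\<close>, the inverse of cosh, every row is built from
  \<alpha>, x, 1 and \<open>t\<close> alone, whose coefficients have odd denominators; the
  determinant is unchanged by \<open>det_fps_mult_unit\<close>.\<close>

lemma wronskian_odd_localization:
  fixes S :: "'k::field_char_0 poly set"
  assumes "unital_subring S" and z: "[:0, 1:] \<in> S"
    and a: "\<And>k. 1 \<le> k \<Longrightarrow> k \<le> n \<Longrightarrow> [:a k:] \<in> S"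
  shows "wronskian a n \<in> odd_localization S"
proof -
  interpret S: unital_subring S by fact
  interpret L: unital_subring "odd_localization S"
    by (rule unital_subring_odd_localization) fact
  obtain u :: "'k poly fps" where u: "cosh_fps * u = 1" using fps_cosh_inverse_exists by blast
  define t where "t = sinh_fps * u"
  have t: "fps_nth t k \<in> odd_localization S" for k
  proof -
    obtain c where c: "fps_nth t k = monom c (2 * k + 1)" "c \<in> odd_localization (range of_int)"
      using fps_tanh_coeff[OF u] unfolding t_def by blast
    then obtain b :: nat and m where b: "odd b" "of_nat b * c = of_int m"
      by (auto simp: odd_localization_def)
    have "of_nat b * fps_nth t k = of_int m * [:0, 1:] ^ (2 * k + 1)"
    proof -
      have "of_nat b * fps_nth t k = Polynomial.smult (of_nat b * c) ([:0, 1:] ^ (2 * k + 1))"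
        by (simp add: c monom_altdef of_nat_poly mult.commute[of c])
      then show ?thesis by (simp add: b of_int_poly del: power_Suc)
    qed
    also have "\<dots> \<in> S" by (intro S.mult_mem S.of_int_mem S.power_mem z)
    finally show ?thesis using b(1) unfolding odd_localization_def by blast
  qed
  \<comment> \<open>The bound \<open>k \<le> n\<close> is essential: the parameters are known to lie
    in \<open>S\<close> only up to index \<open>n\<close>.\<close>
  define good where "good f \<longleftrightarrow> (\<forall>k\<le>n. fps_nth f k \<in> odd_localization S)" for f :: "'k poly fps"
  have good_mult: "good (f * g)" if "good f" "good g" for f g
    using that unfolding good_def fps_mult_nth by (auto intro!: L.sum_mem L.mult_mem)
  have good_add: "good (f + g)" if "good f" "good g" for f g
    using that unfolding good_def by (auto intro!: L.add_mem)
  have good_1: "good 1"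
    unfolding good_def by (auto simp: L.one_mem L.zero_mem)
  have good_X: "good fps_X"
    unfolding good_def by (auto simp: fps_X_def L.one_mem L.zero_mem)
  have good_X_power: "good (fps_X ^ s)" for s
    by (induction s) (auto simp: good_1 good_X good_mult)
  have good_t: "good t" using t by (simp add: good_def)
  have good_a: "good (param_fps a)"
    unfolding good_def fps_nth_param by (auto simp: L.zero_mem intro!: subset_odd_localization a)
  have good_psi: "good (psi_deriv a i * u)" for i
  proof (cases "even i")
    case True
    then obtain s where i: "i = 2 * s" by (elim evenE)
    have "psi_deriv a i * u = fps_X ^ s * (param_fps a * (cosh_fps * u) + fps_X * t)"
      unfolding i psi_deriv_even t_def by (simp add: algebra_simps)
    then show ?thesis by (simp add: u good_mult good_add good_X_power good_X good_t good_a)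
  next
    case False
    then obtain s where i: "i = 2 * s + 1" by (elim oddE)
    have "psi_deriv a i * u = fps_X ^ Suc s * (param_fps a * t + cosh_fps * u)"
      unfolding i psi_deriv_odd t_def by (simp add: algebra_simps)
    then show ?thesis by (simp only: u good_mult good_add good_X_power good_t good_a good_1)
  qed
  have "fps_nth u 0 = 1"
    using arg_cong[OF u, of "\<lambda>f. fps_nth f 0"] by (simp add: cosh_fps_def divided_power_0)
  then have "wronskian a n = det (mat n n (\<lambda>(i, j). fps_nth (psi_deriv a i * u) (Suc j)))"
    unfolding wronskian_def wronskian_entry_def
    by (intro det_fps_mult_unit[symmetric] psi_deriv_nth_0)
  also have "\<dots> \<in> odd_localization S"
    using good_psi by (intro L.det_mem) (auto simp: good_def)
  finally show ?thesis .
qed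

section \<open>Integrality up to powers of 2\<close>

lemma funpow_pderiv_divided_power:
  "(pderiv ^^ i) (divided_power m) = (if i \<le> m then divided_power (m - i) else 0)"
proof (induction i arbitrary: m)
  case (Suc i)
  have "(pderiv ^^ Suc i) (divided_power m :: 'a poly) = (pderiv ^^ i) (pderiv (divided_power m))"
    by (simp add: funpow_swap1)
  then show ?case by (cases m) (auto simp: Suc)
qed simp

text \<open>The scaled coefficient is \<open>fact N / fact m\<close> times the binomial coefficient
  \<open>m choose i\<close>, hence an integer. A free bound \<open>N\<close> lets all terms of one
  column share the multiplier (2j+1)!.\<close>

lemma scaled_divided_power_mem:
  fixes S :: "'k::field_char_0 poly set"
  assumes "unital_subring S" and z: "[:0, 1:] \<in> S" and "m \<le> N"
  shows "Polynomial.smult (fact N / fact i) ((pderiv ^^ i) (divided_power m)) \<in> S"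
proof -
  interpret unital_subring S by fact
  show ?thesis
  proof (cases "i \<le> m")
    case True
    obtain q :: nat where q: "fact N = fact m * q"
      using fact_dvd[OF \<open>m \<le> N\<close>] by (elim dvdE)
    have "(fact N :: 'k) = fact m * of_nat q"
      using arg_cong[OF q, of "of_nat :: nat \<Rightarrow> 'k"] by simp
    then have c: "(fact N / fact i) * inverse (fact (m - i)) = (of_nat (q * (m choose i)) :: 'k)"
      using True by (simp add: binomial_fact field_simps)
    have "Polynomial.smult (fact N / fact i) ((pderiv ^^ i) (divided_power m)) =
        Polynomial.smult ((fact N / fact i) * inverse (fact (m - i))) ([:0, 1:] ^ (m - i) :: 'k poly)"
      using True unfolding funpow_pderiv_divided_power by (simp add: divided_power_def monom_altdef)
    also have "\<dots> = of_nat (q * (m choose i)) * [:0, 1:] ^ (m - i)"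
      unfolding c by (simp add: of_nat_poly del: of_nat_mult)
    also have "\<dots> \<in> S" by (intro mult_mem of_nat_mem power_mem z)
    finally show ?thesis .
  qed (simp add: funpow_pderiv_divided_power zero_mem)
qed

lemma wronskian_entry_eq:
  "wronskian_entry a i j = (\<Sum>k=0..j. [:a (Suc j - k):] * (pderiv ^^ i) (divided_power (2 * k)))
    + (pderiv ^^ i) (divided_power (2 * j + 1))"
proof (induction i)
  case 0
  \<comment> \<open>With cosh as the first factor, the summand \<open>k = Suc j\<close> is the one
    containing the vanishing constant coefficient of \<open>param_fps a\<close>, so the sum stops at
    \<open>j\<close>.\<close>
  have "wronskian_entry a 0 j = (\<Sum>k=0..Suc j. fps_nth cosh_fps k * fps_nth (param_fps a) (Suc j - k))
      + divided_power (2 * j + 1)"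
    using psi_deriv_even[of a 0]
    by (simp add: wronskian_entry_def sinh_fps_def mult.commute[of "param_fps a"] fps_mult_nth[of cosh_fps])
  then show ?case
    by (simp add: fps_nth_param cosh_fps_def mult.commute[of "divided_power _"] Suc_diff_le)
next
  case (Suc i)
  then show ?case
    by (simp add: pderiv_wronskian_entry[symmetric] pderiv_add pderiv_sum pderiv_smult)
qed

lemma scaled_wronskian_entry_mem:
  fixes S :: "'k::field_char_0 poly set"
  assumes S: "unital_subring S" and z: "[:0, 1:] \<in> S"
    and a: "\<And>k. 1 \<le> k \<Longrightarrow> k \<le> Suc j \<Longrightarrow> [:a k:] \<in> S"
  shows "Polynomial.smult (fact (2 * j + 1) / fact i) (wronskian_entry a i j) \<in> S"
proof -
  interpret unital_subring S by fact
  have smult_sum: "Polynomial.smult c (sum f A) = (\<Sum>x\<in>A. Polynomial.smult c (f x))"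
    for c and f :: "nat \<Rightarrow> 'k poly" and A
    by (induction A rule: infinite_finite_induct) (simp_all add: smult_add_right)
  have "Polynomial.smult (fact (2 * j + 1) / fact i) (wronskian_entry a i j) =
      (\<Sum>k=0..j. [:a (Suc j - k):] *
        Polynomial.smult (fact (2 * j + 1) / fact i) ((pderiv ^^ i) (divided_power (2 * k))))
      + Polynomial.smult (fact (2 * j + 1) / fact i) ((pderiv ^^ i) (divided_power (2 * j + 1)))"
    by (simp add: wronskian_entry_eq smult_add_right smult_sum mult.commute)
  also have "\<dots> \<in> S"
    by (intro add_mem sum_mem mult_mem scaled_divided_power_mem S z a) auto
  finally show ?thesis .
qed

text \<open>The splitting (2j+1)! = (2j+1)!! (2j)!!, where (2j)!! = 2^j j! and the index
  \<open>Suc j\<close> stands for (2j+1)!!.\<close>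

lemma fact_odd_dfact: "fact (2 * j + 1) = odd_dfact (Suc j) * 2 ^ j * fact j"
  by (induction j) (auto simp: odd_dfact_def algebra_simps)

lemma prod_fact_A_const:
  "(\<Prod>j<n. fact (2 * j + 1)) = (\<Prod>j<n. 2 ^ j) * A_const n * (\<Prod>j<n. fact j)"
  unfolding fact_odd_dfact A_const_def
  unfolding One_nat_def prod.atLeast1_atMost_eq prod.distrib
  by (simp only: mult_ac)

text \<open>Multiply column \<open>j\<close> by (2j+1)! and divide row \<open>i\<close> by i!. By
  \<open>prod_fact_A_const\<close> the factorials cancel down to a power of 2 times
  \<open>A_const n\<close>; the power of 2 is removed by the odd-denominator estimate.\<close>

lemma wronskian_A_const_mem:
  fixes S :: "'k::field_char_0 poly set"
  assumes S: "unital_subring S" and z: "[:0, 1:] \<in> S"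
    and a: "\<And>k. 1 \<le> k \<Longrightarrow> k \<le> n \<Longrightarrow> [:a k:] \<in> S"
  shows "of_nat (A_const n) * wronskian a n \<in> S"
proof -
  interpret unital_subring S by fact
  define g where "g i j = Polynomial.smult (fact (2 * j + 1) / fact i) (wronskian_entry a i j)" for i j
  have "(\<Prod>i<n. of_nat (fact i)) * det (mat n n (\<lambda>(i, j). g i j)) =
      det (mat n n (\<lambda>(i, j). of_nat (fact i) * g i j))"
    by (rule det_scale_rows[symmetric])
  also have "\<dots> = det (mat n n (\<lambda>(i, j). of_nat (fact (2 * j + 1)) * wronskian_entry a i j))"
    by (rule arg_cong[of _ _ det], rule eq_matI)
      (simp_all add: g_def of_nat_poly del: fact_Suc)
  also have "\<dots> = (\<Prod>j<n. of_nat (fact (2 * j + 1))) * wronskian a n"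
    unfolding wronskian_def by (rule det_scale_columns)
  also have "(\<Prod>j<n. of_nat (fact (2 * j + 1)) :: 'k poly) =
      (\<Prod>i<n. of_nat (fact i)) * of_nat ((\<Prod>j<n. 2 ^ j) * A_const n :: nat)"
    unfolding of_nat_prod[symmetric] of_nat_mult[symmetric] prod_fact_A_const by (simp only: mult_ac)
  finally have "det (mat n n (\<lambda>(i, j). g i j)) = of_nat ((\<Prod>j<n. 2 ^ j) * A_const n) * wronskian a n"
    by (simp add: mult.assoc)
  moreover have "det (mat n n (\<lambda>(i, j). g i j)) \<in> S"
    unfolding g_def by (intro det_mem scaled_wronskian_entry_mem S z a) auto
  ultimately have 1: "of_nat (\<Prod>j<n. 2 ^ j) * (of_nat (A_const n) * wronskian a n) \<in> S"
    by (simp add: mult.assoc)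
  have "wronskian a n \<in> odd_localization S"
    by (rule wronskian_odd_localization[OF S z]) (rule a)
  then obtain b :: nat where b: "odd b" "of_nat b * wronskian a n \<in> S"
    unfolding odd_localization_def by blast
  have 2: "of_nat b * (of_nat (A_const n) * wronskian a n) \<in> S"
    using mult_mem[OF of_nat_mem[of "A_const n"] b(2)] by (simp add: mult_ac)
  have "coprime (\<Prod>j<n. 2 ^ j) b"
    using b(1) by (intro prod_coprime_left) simp
  with 1 2 show ?thesis by (rule coprime_multiples_mem)
qed

section \<open>Prescribing the initial data\<close>

text \<open>Makes the results over \<open>field_char_0\<close> available for
  \<open>ratfun\<close>.\<close>

instance fract :: ("{idom, ring_char_0}") field_char_0
proof
  show "inj (of_nat :: nat \<Rightarrow> 'a fract)"
    by (rule injI) (simp add: of_nat_fract eq_fract)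
qed

text \<open>
  Solves \<open>const_wronskian a n = c n\<close> for \<open>a n\<close> (see \<open>const_wronskian_last\<close>); this needs \<open>c 0 = 1\<close>,
  and for \<open>n = 1\<close> the truncated \<open>n - 2\<close> correctly gives the divisor \<open>c 0\<close>.
\<close>

function wronskian_params :: "(nat \<Rightarrow> 'k::field) \<Rightarrow> nat \<Rightarrow> 'k" where
  "wronskian_params c n = (-1) ^ (n - 1) *
    (c n - const_wronskian (\<lambda>j. if j < n then wronskian_params c j else 0) n) / c (n - 2)"
  by auto
termination by (relation "measure snd") auto

declare wronskian_params.simps [simp del]

text \<open>By strong induction the divisor \<open>c (m - 1)\<close> is the coefficient of the
  newest parameter in \<open>const_wronskian_last\<close>, up to the sign \<open>(-1) ^ m\<close>,
  which cancels against that in the definition.\<close>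

lemma const_wronskian_params:
  assumes "c 0 = 1" and nz: "\<And>k. c k \<noteq> 0"
  shows "const_wronskian (wronskian_params c) n = c n"
proof (induction n rule: less_induct)
  case (less n)
  let ?a = "wronskian_params c"
  show ?case
  proof (cases n)
    case 0
    then show ?thesis by (simp add: const_wronskian_def assms)
  next
    case (Suc m)
    have trunc: "const_wronskian (?a(Suc m := 0)) (Suc m) =
        const_wronskian (\<lambda>j. if j < Suc m then ?a j else 0) (Suc m)"
      by (rule const_wronskian_cong) auto
    have "const_wronskian ?a (m - 1) = c (m - 1)" using less[of "m - 1"] Suc by auto
    moreover have "(-1) ^ m * ?a (Suc m) * c (m - 1) =
        ((-1) ^ m * (-1) ^ m) * (c (Suc m) - const_wronskian (\<lambda>j. if j < Suc m then ?a j else 0) (Suc m))"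
      by (subst wronskian_params.simps) (simp add: nz)
    ultimately show ?thesis
      unfolding Suc const_wronskian_last[of ?a m] trunc by (simp add: power_mult_distrib[symmetric])
  qed
qed

lemma const_wronskian_mem:
  assumes "unital_subring S" and "\<And>k. 1 \<le> k \<Longrightarrow> k \<le> n \<Longrightarrow> a k \<in> S"
  shows "const_wronskian a n \<in> S"
proof -
  interpret unital_subring S by fact
  show ?thesis
    unfolding const_wronskian_def by (rule det_mem) (auto simp: assms zero_mem one_mem)
qed

section \<open>Specialization to the indeterminates\<close>

lemma indet_nonzero: "indet k \<noteq> 0"
proof -
  have "Poly_Mapping.single m (1 :: rat) \<noteq> 0" for m :: "nat \<Rightarrow>\<^sub>0 nat"
    by (metis lookup_single_eq lookup_zero one_neq_zero)
  then show ?thesis by (simp add: indet_def Zero_fract_def eq_fract)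
qed

lemma generated_subring_mono: "S \<subseteq> T \<Longrightarrow> generated_subring S \<subseteq> generated_subring T"
proof
  fix x assume "S \<subseteq> T" "x \<in> generated_subring S"
  from this(2,1) show "x \<in> generated_subring T"
    by (induction rule: generated_subring.induct) (auto intro: generated_subring.intros)
qed

lemma int_laurent_ring_mono: "m \<le> n \<Longrightarrow> int_laurent_ring m \<subseteq> int_laurent_ring n"
  unfolding int_laurent_ring_def by (rule generated_subring_mono) fastforce

lemma unital_subring_int_laurent_ring: "unital_subring (int_laurent_ring n)"
  unfolding int_laurent_ring_def by standard (auto intro: generated_subring.intros)

text \<open>Index 0 carries the constant term of the polynomial with index 0, namely 1, in place of
  the junk value \<open>indet 0\<close>.\<close>

definition initial_data :: "nat \<Rightarrow> ratfun" where
  "initial_data k = (if k = 0 then 1 else indet k)"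

text \<open>Transfers membership to the coefficient field, where the parameters and
  \<open>const_wronskian\<close> live.\<close>

lemma unital_subring_constants:
  fixes S :: "'a::comm_ring_1 poly set"
  assumes "unital_subring S"
  shows "unital_subring {x. [:x:] \<in> S}"
proof -
  interpret unital_subring S by fact
  show ?thesis
  proof
    show "1 \<in> {x. [:x:] \<in> S}" using one_mem by (simp add: one_pCons)
    fix x y assume "x \<in> {x. [:x:] \<in> S}" "y \<in> {x. [:x:] \<in> S}"
    then show "x - y \<in> {x. [:x:] \<in> S}" "x * y \<in> {x. [:x:] \<in> S}"
      using diff_mem[of "[:x:]" "[:y:]"] mult_mem[of "[:x:]" "[:y:]"] by (simp_all add: mult.commute)
  qed
qed

lemma wronskian_params_mem:
  assumes "1 \<le> n"
  shows "[:wronskian_params initial_data n:] \<in> int_laurent_ring n"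
  using assms
proof (induction n rule: less_induct)
  case (less n)
  interpret R: unital_subring "int_laurent_ring n" by (rule unital_subring_int_laurent_ring)
  have inner: "unital_subring {x. [:x:] \<in> int_laurent_ring n}"
    by (rule unital_subring_constants) (rule unital_subring_int_laurent_ring)
  interpret C: unital_subring "{x. [:x:] \<in> int_laurent_ring n}" by (rule inner)
  have a: "wronskian_params initial_data k \<in> {x. [:x:] \<in> int_laurent_ring n}" if "1 \<le> k" "k < n" for k
    using less.IH[of k] that int_laurent_ring_mono[of k n] by auto
  have c: "initial_data n \<in> {x. [:x:] \<in> int_laurent_ring n}"
    using less.prems by (auto simp: initial_data_def int_laurent_ring_def intro!: generated_subring.gen)
  \<comment> \<open>For \<open>n \<le> 2\<close> the truncated index is 0 and the divisor is 1, so
    no indeterminate is inverted.\<close>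
  have i: "inverse (initial_data (n - 2)) \<in> {x. [:x:] \<in> int_laurent_ring n}"
  proof (cases "n \<le> 2")
    case True
    then show ?thesis using C.one_mem by (simp add: initial_data_def)
  next
    case False
    then show ?thesis
      by (auto simp: initial_data_def int_laurent_ring_def intro!: generated_subring.gen exI[of _ "n - 2"])
  qed
  have "wronskian_params initial_data n \<in> {x. [:x:] \<in> int_laurent_ring n}"
    unfolding wronskian_params.simps[of _ n] divide_inverse
    by (intro C.mult_mem C.power_mem C.uminus_mem C.one_mem C.diff_mem c i const_wronskian_mem inner)
      (auto simp: a[simplified] C.zero_mem[simplified])
  then show ?case by simp
qed

theorem corollary3:
  shows "\<exists>P :: int \<Rightarrow> ratfun poly.
           burchnall_chaundy P \<and>
           (\<forall>n::nat. n \<ge> 1 \<longrightarrow>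
              of_nat (A_const n) * P (int n) \<in> int_laurent_ring n)"
proof -
  define a where "a = wronskian_params initial_data"
  define P where "P k = (if k < 0 then 1 else wronskian a (nat k))" for k :: int
  have init: "poly (wronskian a n) 0 = initial_data n" for n
    unfolding poly_wronskian_0 a_def
    by (rule const_wronskian_params) (simp_all add: initial_data_def indet_nonzero)
  \<comment> \<open>The constant term is 1 or an indeterminate; nonvanishing is what the
    Desnanot-Jacobi argument requires.\<close>
  have nz: "wronskian a n \<noteq> 0" for n
  proof
    assume "wronskian a n = 0"
    then show False using init[of n] by (simp add: initial_data_def indet_nonzero split: if_splits)
  qed
  have "pderiv (P (k + 1)) * P (k - 1) - P (k + 1) * pderiv (P (k - 1)) = (P k)\<^sup>2" if "k \<ge> 0" for k
  \<comment> \<open>Index -1 lies outside the Wronskian family; there the relation reduces to the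
    derivative of the first Wronskian being 1.\<close>
  proof (cases "k = 0")
    case True
    then show ?thesis by (simp add: P_def wronskian_0 pderiv_wronskian_1)
  next
    case False
    define n where "n = nat (k - 1)"
    have "k = int (Suc n)" using False that by (simp add: n_def)
    then show ?thesis
      using burchnall_chaundy_wronskian[OF nz, of n] by (simp add: P_def nat_add_distrib)
  qed
  then have "burchnall_chaundy P"
    unfolding burchnall_chaundy_def
    by (auto simp: P_def wronskian_0 init initial_data_def)
  moreover have "of_nat (A_const n) * P (int n) \<in> int_laurent_ring n" for n
  proof -
    have "[:0, 1:] \<in> int_laurent_ring n"
      by (auto simp: int_laurent_ring_def intro: generated_subring.gen)
    moreover have "[:a k:] \<in> int_laurent_ring n" if "1 \<le> k" "k \<le> n" for k
      using wronskian_params_mem[OF that(1)] int_laurent_ring_mono[OF that(2)] by (auto simp: a_def)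
    ultimately show ?thesis
      by (simp add: P_def wronskian_A_const_mem unital_subring_int_laurent_ring)
  qed
  ultimately show ?thesis by blast
qed

end
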